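(* Consider the constrained problem $\min_{\mathrm{y}\in\mathbb{R}^n}\sum_{i\in\mathcal{A}} f_i(\mathrm{y})$ subject to $g_{il}(\mathrm{y})\le 0$ for all $l\in\mathcal{C}_{\mathrm{in},i}$, $i\in\mathcal{A}$, and $h_{ij}(\mathrm{y})=0$ for all $j\in\mathcal{C}_{\mathrm{eq},i}$, $i\in\mathcal{A}$, with $\mathcal{A}=\{1,\dots,N\}$. Consider agent systems $\Sigma_i$, $i\in\mathcal{A}$, and controller systems $\Pi_k$, $k\in\mathcal{C}=\{1,\dots,K\}$, interconnected by $\zeta=(E\otimes I_n)^\top y$ and $u=-(E\otimes I_n)d$, where $E\in\mathbb{R}^{N\times K}$ is the incidence matrix of a connected communication graph. Suppose that the equilibria of each agent system $\Sigma_i$ fulfill, with multipliers $\bar\lambda_i=\mathrm{col}(\bar\lambda_{il})$ and $\bar\mu_i=\mathrm{col}(\bar\mu_{ij})$, $$\bar u_i=\nabla_{\mathrm{y}}L_i(\bar y_i,\bar\lambda_i,\bar\mu_i),\quad g_{il}(\bar y_i)\le 0,\quad h_{ij}(\bar y_i)=0,\quad \bar\lambda_{il}\ge 0,\quad \bar\lambda_{il}\,g_{il}(\bar y_i)=0$$ for all $l\in\mathcal{C}_{\mathrm{in},i}$ and $j\in\mathcal{C}_{\mathrm{eq},i}$, and that every controller $\Pi_k$ is a system with integral action. Then all equilibria $(\bar y,\bar d)$ of the networked system lie in the manifold $$\mathcal{M}_{\mathrm{eq}}=\{(\bar y,\bar d)\in\mathbb{R}^{Nn}\times\mathbb{R}^{Kn}\mid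 \bar y=1_N\otimes \mathrm{y}^*\},$$ where $\mathrm{y}^*$ is the minimizer of the constrained problem.
   Context: Standing assumptions: $f_i,g_{il},h_{ij}:\mathbb{R}^n\to\mathbb{R}$ are differentiable, the $g_{il}$ are convex, the $h_{ij}$ are affine ($h_{ij}(\mathrm{y})=a_{ij}^\top\mathrm{y}+c_{ij}$), the optimization problem is strictly convex (the sum $\sum_i f_i$ is strictly convex), so its minimizer $\mathrm{y}^*$ is unique, and Slater's condition holds: there is a $\mathrm{y}\in\mathbb{R}^n$ with $h_{ij}(\mathrm{y})=0$ and $g_{il}(\mathrm{y})<0$ for all $i,j,l$. The index sets $\mathcal{C}_{\mathrm{in},i}$, $\mathcal{C}_{\mathrm{eq},i}$ are finite. Lagrange function of agent $i$: $L_i(\mathrm{y},\lambda_i,\mu_i)=f_i(\mathrm{y})+\sum_{l\in\mathcal{C}_{\mathrm{in},i}}\lambda_{il}g_{il}(\mathrm{y})+\sum_{j\in\mathcal{C}_{\mathrm{eq},i}}\mu_{ij}h_{ij}(\mathrm{y})$. Agent systems: $\Sigma_i:\ \dot x_i=\chi_i(x_i,u_i),\ y_i=\psi_i(x_i,u_i)$ with $u_i,y_i\in\mathbb{R}^n$. An equilibrium $(\bar x_i,\bar u_i,\bar y_i)$ satisfies $\chi_i(\bar x_i,\bar u_i)=0$ and $\bar y_i=\psi_i(\bar x_i,\bar u_i)$; the hypothesis says that for each such equilibrium there are multipliers $\bar\lambda_i,\bar\mu_i$ (which may be part of the agent's internal state) such that the displayed relations hold. Controller systems: $\Pi_k:\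 \dot z_k=\Phi_k(z_k,\zeta_k),\ d_k=\sigma_k(z_k)$ with $z_k,\zeta_k,d_k\in\mathbb{R}^n$. A system has integral action if no input other than the zero input leads to an equilibrium, i.e. $\Phi_k(\bar z_k,\bar\zeta_k)=0$ implies $\bar\zeta_k=0$. Stacked variables: $y=\mathrm{col}(y_i)$, $u=\mathrm{col}(u_i)$, $\zeta=\mathrm{col}(\zeta_k)$, $d=\mathrm{col}(d_k)$. An equilibrium of the networked system consists of equilibria of all $\Sigma_i$ and $\Pi_k$ whose inputs and outputs satisfy the interconnection equations. Incidence matrix: the nodes of the graph are the agents, its edges are in bijection with the controllers, and (after fixing an arbitrary orientation) $E=(m_{ij})$ with $m_{ij}=-1$ if edge $j$ leaves node $i$, $m_{ij}=1$ if edge $j$ enters node $i$, and $m_{ij}=0$ otherwise. $1_N$ is the all-ones vector. *)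

theory Defs
  imports "HOL-Analysis.Analysis" "Graph_Theory.Digraph_Component"
begin

section \<open>Stacked vectors and Kronecker products\<close>

text \<open>
  Matrices are functions of two indices, used together with finite index sets; vectors are
  functions that are \<open>undefined\<close> off their index set. A vector in \<open>\<real>\<^sup>N\<^sup>n\<close> made of
  \<open>N\<close> blocks from \<open>\<real>\<^sup>n\<close> is indexed by pairs (block, component), the
  dimension \<open>n\<close> being the cardinality of the index type. Block indices are natural numbers
  rather than a finite type so that an empty set of controllers (a single agent) is allowed.
\<close>

definition stack_index :: "nat set \<Rightarrow> (nat \<times> 'n::finite) set" where
  "stack_index I = I \<times> UNIV"

definition stacked :: "nat set \<Rightarrow> (nat \<times> 'n::finite \<Rightarrow> real) set" where
  "stacked I = stack_index I \<rightarrow>\<^sub>E UNIV"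

definition col :: "nat set \<Rightarrow> (nat \<Rightarrow> real^'n) \<Rightarrow> (nat \<times> 'n::finite \<Rightarrow> real)" where
  "col I v = restrict (\<lambda>(i, l). v i $ l) (stack_index I)"

definition mat_vec :: "'r set \<Rightarrow> 's set \<Rightarrow> ('r \<Rightarrow> 's \<Rightarrow> real) \<Rightarrow> ('s \<Rightarrow> real) \<Rightarrow> ('r \<Rightarrow> real)" where
  "mat_vec R S M v = restrict (\<lambda>r. \<Sum>s\<in>S. M r s * v s) R"

definition mat_transpose :: "('r \<Rightarrow> 's \<Rightarrow> real) \<Rightarrow> ('s \<Rightarrow> 'r \<Rightarrow> real)" where
  "mat_transpose M = (\<lambda>s r. M r s)"

definition mat_uminus :: "('r \<Rightarrow> 's \<Rightarrow> real) \<Rightarrow> ('r \<Rightarrow> 's \<Rightarrow> real)" where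
  "mat_uminus M = (\<lambda>r s. - M r s)"

definition id_mat :: "'r \<Rightarrow> 'r \<Rightarrow> real" where
  "id_mat = (\<lambda>r s. if r = s then 1 else 0)"

definition kron :: "('a \<Rightarrow> 'b \<Rightarrow> real) \<Rightarrow> ('c \<Rightarrow> 'd \<Rightarrow> real) \<Rightarrow> ('a \<times> 'c \<Rightarrow> 'b \<times> 'd \<Rightarrow> real)" where
  "kron A B = (\<lambda>(i, k) (j, l). A i j * B k l)"

definition kron_vec :: "nat set \<Rightarrow> (nat \<Rightarrow> real) \<Rightarrow> real^'n \<Rightarrow> (nat \<times> 'n::finite \<Rightarrow> real)" where
  "kron_vec I a w = restrict (\<lambda>(i, l). a i * w $ l) (stack_index I)"

section \<open>Incidence matrix\<close>

text \<open>
  An oriented graph is given by its digraph of arcs. Arcs are named, so edges can be identified with controllers.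
\<close>

definition incidence_matrix :: "('v, 'e) pre_digraph \<Rightarrow> 'v \<Rightarrow> 'e \<Rightarrow> real" where
  "incidence_matrix G v e =
     (if tail G e = v then - 1 else if head G e = v then 1 else 0)"

section \<open>The optimization problem\<close>

definition strictly_convex_on :: "'a::real_vector set \<Rightarrow> ('a \<Rightarrow> real) \<Rightarrow> bool" where
  "strictly_convex_on S f \<longleftrightarrow> convex S \<and>
     (\<forall>x\<in>S. \<forall>y\<in>S. \<forall>u>0. \<forall>v>0. x \<noteq> y \<longrightarrow> u + v = 1 \<longrightarrow>
        f (u *\<^sub>R x + v *\<^sub>R y) < u * f x + v * f y)"

definition feasible ::
  "nat \<Rightarrow> (nat \<Rightarrow> 'l set) \<Rightarrow> (nat \<Rightarrow> 'j set) \<Rightarrow> (nat \<Rightarrow> 'l \<Rightarrow> real^'n \<Rightarrow> real)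
    \<Rightarrow> (nat \<Rightarrow> 'j \<Rightarrow> real^'n \<Rightarrow> real) \<Rightarrow> real^'n::finite \<Rightarrow> bool" where
  "feasible N Cin Ceq g h y \<longleftrightarrow>
     (\<forall>i\<in>{1..N}. (\<forall>l\<in>Cin i. g i l y \<le> 0) \<and> (\<forall>j\<in>Ceq i. h i j y = 0))"

definition slater ::
  "nat \<Rightarrow> (nat \<Rightarrow> 'l set) \<Rightarrow> (nat \<Rightarrow> 'j set) \<Rightarrow> (nat \<Rightarrow> 'l \<Rightarrow> real^'n \<Rightarrow> real)
    \<Rightarrow> (nat \<Rightarrow> 'j \<Rightarrow> real^'n::finite \<Rightarrow> real) \<Rightarrow> bool" where
  "slater N Cin Ceq g h \<longleftrightarrow>
     (\<exists>y. \<forall>i\<in>{1..N}. (\<forall>l\<in>Cin i. g i l y < 0) \<and> (\<forall>j\<in>Ceq i. h i j y = 0))"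

definition lagrangian ::
  "'l set \<Rightarrow> 'j set \<Rightarrow> (real^'n \<Rightarrow> real) \<Rightarrow> ('l \<Rightarrow> real^'n \<Rightarrow> real) \<Rightarrow> ('j \<Rightarrow> real^'n \<Rightarrow> real)
    \<Rightarrow> real^'n::finite \<Rightarrow> ('l \<Rightarrow> real) \<Rightarrow> ('j \<Rightarrow> real) \<Rightarrow> real" where
  "lagrangian I J f g h y lam mu = f y + (\<Sum>l\<in>I. lam l * g l y) + (\<Sum>j\<in>J. mu j * h j y)"

section \<open>Agents, controllers and their interconnection\<close>

text \<open>
  The state of an agent lives in \<open>\<real>\<^sup>m\<close>, where \<open>m\<close> may differ from agent to agent;
  only the components below \<open>m\<close> of the right-hand side \<open>chi x u\<close> of the state equation matter.
\<close>

definition agent_equilibrium ::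
  "nat \<Rightarrow> ((nat \<Rightarrow> real) \<Rightarrow> real^'n \<Rightarrow> nat \<Rightarrow> real) \<Rightarrow> ((nat \<Rightarrow> real) \<Rightarrow> real^'n \<Rightarrow> real^'n)
    \<Rightarrow> (nat \<Rightarrow> real) \<Rightarrow> real^'n \<Rightarrow> real^'n::finite \<Rightarrow> bool" where
  "agent_equilibrium m chi psi x u y \<longleftrightarrow>
     x \<in> {..<m} \<rightarrow>\<^sub>E UNIV \<and> (\<forall>s<m. chi x u s = 0) \<and> y = psi x u"

definition controller_equilibrium ::
  "(real^'n \<Rightarrow> real^'n \<Rightarrow> real^'n) \<Rightarrow> (real^'n \<Rightarrow> real^'n)
    \<Rightarrow> real^'n \<Rightarrow> real^'n \<Rightarrow> real^'n::finite \<Rightarrow> bool" where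
  "controller_equilibrium Phi sgm z zeta d \<longleftrightarrow> Phi z zeta = 0 \<and> d = sgm z"

definition integral_action :: "(real^'n \<Rightarrow> real^'n \<Rightarrow> real^'n::finite) \<Rightarrow> bool" where
  "integral_action Phi \<longleftrightarrow> (\<forall>z zeta. Phi z zeta = 0 \<longrightarrow> zeta = 0)"

definition network_equilibrium ::
  "nat \<Rightarrow> nat \<Rightarrow> (nat \<Rightarrow> nat \<Rightarrow> real)
    \<Rightarrow> (nat \<Rightarrow> nat) \<Rightarrow> (nat \<Rightarrow> (nat \<Rightarrow> real) \<Rightarrow> real^'n \<Rightarrow> nat \<Rightarrow> real)
    \<Rightarrow> (nat \<Rightarrow> (nat \<Rightarrow> real) \<Rightarrow> real^'n \<Rightarrow> real^'n)
    \<Rightarrow> (nat \<Rightarrow> real^'n \<Rightarrow> real^'n \<Rightarrow> real^'n) \<Rightarrow> (nat \<Rightarrow> real^'n \<Rightarrow> real^'n)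
    \<Rightarrow> (nat \<Rightarrow> nat \<Rightarrow> real) \<Rightarrow> (nat \<Rightarrow> real^'n) \<Rightarrow> (nat \<Rightarrow> real^'n)
    \<Rightarrow> (nat \<Rightarrow> real^'n) \<Rightarrow> (nat \<Rightarrow> real^'n) \<Rightarrow> (nat \<Rightarrow> real^'n::finite) \<Rightarrow> bool" where
  "network_equilibrium N K E m chi psi Phi sgm x u y z zeta d \<longleftrightarrow>
     (\<forall>i\<in>{1..N}. agent_equilibrium (m i) (chi i) (psi i) (x i) (u i) (y i)) \<and>
     (\<forall>k\<in>{1..K}. controller_equilibrium (Phi k) (sgm k) (z k) (zeta k) (d k)) \<and>
     col {1..K} zeta = mat_vec (stack_index {1..K}) (stack_index {1..N})
       (mat_transpose (kron E id_mat)) (col {1..N} y) \<and>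
     col {1..N} u = mat_vec (stack_index {1..N}) (stack_index {1..K})
       (mat_uminus (kron E id_mat)) (col {1..K} d)"

definition equilibrium_manifold ::
  "nat \<Rightarrow> nat \<Rightarrow> real^'n \<Rightarrow> ((nat \<times> 'n::finite \<Rightarrow> real) \<times> (nat \<times> 'n \<Rightarrow> real)) set" where
  "equilibrium_manifold N K ystar =
     {(y, d). y \<in> stacked {1..N} \<and> d \<in> stacked {1..K} \<and> y = kron_vec {1..N} (\<lambda>_. 1) ystar}"

end

theory Submission
  imports Defs
begin

text \<open>
  At a network equilibrium, integral action forces \<open>\<zeta> = 0\<close>, so the outputs of adjacent agents
  agree and, by connectedness, all agents share one output \<open>y\<^sub>0\<close>. The columns of the
  incidence matrix sum to zero, hence so do the agent inputs, which are the gradients at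
  \<open>y\<^sub>0\<close> of the agents' Lagrange functions. Thus \<open>y\<^sub>0\<close> is a critical point of the
  sum of these, which is strictly convex even though no single \<open>f\<^sub>i\<close> need be convex, and
  therefore its strict minimizer. A minimizer \<open>y\<^sup>*\<noteq> y\<^sub>0\<close> would give
  \<open>\<Sum>\<^sub>i f\<^sub>i(y\<^sup>*) \<ge> \<Sum>\<^sub>i L\<^sub>i(y\<^sup>*) > \<Sum>\<^sub>i L\<^sub>i(y\<^sub>0) = \<Sum>\<^sub>i f\<^sub>i(y\<^sub>0)\<close>
  by complementary slackness, contradicting optimality.
\<close>

section \<open>Critical points of strictly convex functions\<close>

text \<open>\<open>convex S\<close> covers the empty sum, because \<open>convex_on\<close> includes
  convexity of its domain; an agent may have no constraints at all.\<close>

lemma convex_on_sum_functions: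
  assumes "finite A" "convex S" "\<And>i. i \<in> A \<Longrightarrow> convex_on S (F i)"
  shows "convex_on S (\<lambda>x. \<Sum>i\<in>A. F i x)"
  using assms(1,3)
proof (induction A)
  case empty
  then show ?case using \<open>convex S\<close> by (simp add: convex_on_const)
next
  case (insert i A)
  then show ?case by (simp add: convex_on_add)
qed

text \<open>For an affine function the convexity inequality is an equality, so it survives a factor
  \<open>r\<close> of either sign. This suits the multipliers of equality constraints, which carry
  no sign condition.\<close>

lemma convex_on_affine:
  fixes b :: "'a::real_inner"
  shows "convex_on UNIV (\<lambda>x. r * (b \<bullet> x + c))"
  by (rule convex_onI) (auto simp: inner_simps algebra_simps)

lemma strictly_convex_onD:
  assumes "strictly_convex_on S f" "x \<in> S" "y \<in> S" "x \<noteq> y" "u > 0" "v > 0" "u + v = 1"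
  shows "f (u *\<^sub>R x + v *\<^sub>R y) < u * f x + v * f y"
  using assms unfolding strictly_convex_on_def by blast

text \<open>Lets all strictness come from the sum of the objectives, with the weighted constraints
  contributing only convexity.\<close>

lemma strictly_convex_on_add_convex:
  assumes "strictly_convex_on S f" "convex_on S p"
  shows "strictly_convex_on S (\<lambda>x. f x + p x)"
  unfolding strictly_convex_on_def
proof (intro conjI ballI allI impI)
  show "convex S"
    using assms(1) by (simp add: strictly_convex_on_def)
next
  fix x y and u v :: real
  assume xy: "x \<in> S" "y \<in> S" "x \<noteq> y" and uv: "0 < u" "0 < v" "u + v = 1"
  have "f (u *\<^sub>R x + v *\<^sub>R y) < u * f x + v * f y"
    using strictly_convex_onD[OF assms(1)] xy uv .
  moreover have "p (u *\<^sub>R x + v *\<^sub>R y) \<le> u * p x + v * p y"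
    using assms(2) xy uv unfolding convex_on_def by auto
  ultimately show "f (u *\<^sub>R x + v *\<^sub>R y) + p (u *\<^sub>R x + v *\<^sub>R y)
      < u * (f x + p x) + v * (f y + p y)"
    by (simp add: algebra_simps)
qed

lemma strictly_convex_on_imp_convex_on:
  assumes "strictly_convex_on S f"
  shows "convex_on S f"
proof (rule convex_onI)
  show "convex S"
    using assms by (simp add: strictly_convex_on_def)
next
  fix t :: real and x y
  assume t: "0 < t" "t < 1" and xy: "x \<in> S" "y \<in> S"
  show "f ((1 - t) *\<^sub>R x + t *\<^sub>R y) \<le> (1 - t) * f x + t * f y"
  proof (cases "x = y")
    case True
    then show ?thesis by (simp add: algebra_simps flip: scaleR_left_distrib)
  next
    case False
    have "1 - t > 0" "(1 - t) + t = 1"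
      using t by auto
    then show ?thesis
      using strictly_convex_onD[OF assms xy False] t(1) by (simp add: less_imp_le)
  qed
qed

text \<open>Convexity bounds the difference quotients of \<open>f\<close> from \<open>x\<close>
  towards \<open>y\<close> by \<open>f y - f x\<close>, while these quotients tend to the
  directional derivative 0. Differentiability at the single point \<open>x\<close> suffices.\<close>

lemma convex_critical_point_is_minimum:
  fixes f :: "'a::real_inner \<Rightarrow> real"
  assumes f: "convex_on UNIV f" and "GDERIV f x :> 0"
  shows "f x \<le> f y"
proof -
  \<comment> \<open>The base point is written as the line evaluated at 0, to fit the chain rule
    below.\<close>
  have df: "(f has_derivative (\<lambda>_. 0)) (at (x + 0 *\<^sub>R (y - x)))"
    using assms(2) by (simp add: gderiv_def)
  have dline: "((\<lambda>t. x + t *\<^sub>R (y - x)) has_derivative (\<lambda>t. t *\<^sub>R (y - x))) (at (0::real))"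
    by (auto intro!: derivative_eq_intros)
  have "((\<lambda>t. f (x + t *\<^sub>R (y - x))) has_field_derivative 0) (at 0)"
    using has_derivative_compose[OF dline df] by (simp add: has_field_derivative_def lambda_zero)
  \<comment> \<open>The limit is restricted to the right because the convexity bound holds for
    \<open>t\<close> in the open interval from 0 to 1.\<close>
  then have "((\<lambda>t. (f (x + t *\<^sub>R (y - x)) - f x) / t) \<longlongrightarrow> 0) (at_right 0)"
    by (auto simp: has_field_derivative_iff intro: tendsto_within_subset)
  moreover have "\<forall>\<^sub>F t in at_right 0. (f (x + t *\<^sub>R (y - x)) - f x) / t \<le> f y - f x"
  proof (rule eventually_at_rightI[of 0 1])
    fix t :: real assume "t \<in> {0<..<1}"
    then have t: "0 < t" "t < 1" by auto
    have "x + t *\<^sub>R (y - x) = (1 - t) *\<^sub>R x + t *\<^sub>R y"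
      by (simp add: algebra_simps)
    then have "f (x + t *\<^sub>R (y - x)) \<le> (1 - t) * f x + t * f y"
      using convex_onD[OF f, of t x y] t by simp
    then show "(f (x + t *\<^sub>R (y - x)) - f x) / t \<le> f y - f x"
      using t by (simp add: pos_divide_le_eq right_diff_distrib left_diff_distrib mult.commute)
  qed simp
  ultimately have "0 \<le> f y - f x"
    by (rule tendsto_upperbound) simp
  then show ?thesis by simp
qed

lemma strictly_convex_critical_point_is_strict_minimum:
  fixes f :: "'a::real_inner \<Rightarrow> real"
  assumes f: "strictly_convex_on UNIV f" and d: "GDERIV f x :> 0" and "x \<noteq> y"
  shows "f x < f y"
proof -
  \<comment> \<open>The midpoint turns weak minimality into a strict inequality: its value is at
    least \<open>f x\<close> but strictly below the average of \<open>f x\<close> and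
    \<open>f y\<close>.\<close>
  have "f x \<le> f ((1/2) *\<^sub>R x + (1/2) *\<^sub>R y)"
    using strictly_convex_on_imp_convex_on[OF f] d by (rule convex_critical_point_is_minimum)
  also have "\<dots> < 1/2 * f x + 1/2 * f y"
    using strictly_convex_onD[OF f _ _ \<open>x \<noteq> y\<close>, of "1/2" "1/2"] by simp
  finally show ?thesis by simp
qed

lemma GDERIV_sum:
  assumes "\<And>i. i \<in> A \<Longrightarrow> GDERIV (F i) x :> D i"
  shows "GDERIV (\<lambda>x. \<Sum>i\<in>A. F i x) x :> (\<Sum>i\<in>A. D i)"
  using assms unfolding gderiv_def inner_sum_right by (rule has_derivative_sum)

section \<open>Incidence matrices\<close>

text \<open>The identity factor collapses the sum over components, so a Kronecker product with it
  acts blockwise. Both interconnection equations reduce to this sum.\<close>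

lemma sum_kron_id_mat:
  fixes w :: "nat \<Rightarrow> real^'n::finite"
  assumes "finite I"
  shows "(\<Sum>s\<in>stack_index I. a (fst s) * id_mat (snd s) l * col I w s)
    = (\<Sum>i\<in>I. a i * w i $ l)"
proof -
  have "(\<Sum>s\<in>stack_index I. a (fst s) * id_mat (snd s) l * col I w s)
      = (\<Sum>i\<in>I. \<Sum>l'\<in>UNIV. a i * id_mat l' l * w i $ l')"
    unfolding stack_index_def sum.cartesian_product
    by (rule sum.cong) (auto simp: col_def stack_index_def)
  also have "\<dots> = (\<Sum>i\<in>I. \<Sum>l'\<in>UNIV. if l' = l then a i * w i $ l' else 0)"
    by (intro sum.cong) (auto simp: id_mat_def)
  finally show ?thesis by simp
qed

lemma id_mat_commute: "id_mat r s = id_mat s r"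
  by (auto simp: id_mat_def)

lemma col_eq_kron_transpose_mat_vec:
  fixes v w :: "nat \<Rightarrow> real^'n::finite"
  assumes "finite I" "k \<in> J"
    and "col J v = mat_vec (stack_index J) (stack_index I) (mat_transpose (kron E id_mat)) (col I w)"
  shows "v k = (\<Sum>i\<in>I. E i k *\<^sub>R w i)"
proof (rule vec_eq_iff[THEN iffD2, rule_format])
  fix l :: 'n
  have "v k $ l = col J v (k, l)"
    using assms(2) by (simp add: col_def stack_index_def)
  also have "\<dots> = (\<Sum>s\<in>stack_index I. E (fst s) k * id_mat (snd s) l * col I w s)"
    using assms(2) unfolding assms(3)
    by (simp add: mat_vec_def stack_index_def mat_transpose_def kron_def case_prod_beta)
  finally show "v k $ l = (\<Sum>i\<in>I. E i k *\<^sub>R w i) $ l"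
    by (simp add: sum_kron_id_mat[OF assms(1), of "\<lambda>i. E i k"])
qed

lemma col_eq_kron_uminus_mat_vec:
  fixes v w :: "nat \<Rightarrow> real^'n::finite"
  assumes "finite J" "i \<in> I"
    and "col I v = mat_vec (stack_index I) (stack_index J) (mat_uminus (kron E id_mat)) (col J w)"
  shows "v i = (\<Sum>k\<in>J. - E i k *\<^sub>R w k)"
proof (rule vec_eq_iff[THEN iffD2, rule_format])
  fix l :: 'n
  have "v i $ l = col I v (i, l)"
    using assms(2) by (simp add: col_def stack_index_def)
  \<comment> \<open>Without the transpose the identity factor arises as
    \<open>id_mat l (snd s)\<close>; its symmetry restores the order used in
    \<open>sum_kron_id_mat\<close>.\<close>
  also have "\<dots> = (\<Sum>s\<in>stack_index J. - E i (fst s) * id_mat (snd s) l * col J w s)"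
    using assms(2) unfolding assms(3)
    by (simp add: mat_vec_def stack_index_def mat_uminus_def kron_def case_prod_beta
        id_mat_commute[of l])
  also have "\<dots> = (\<Sum>k\<in>J. - E i k * w k $ l)"
    by (rule sum_kron_id_mat[OF assms(1)])
  finally show "v i $ l = (\<Sum>k\<in>J. - E i k *\<^sub>R w k) $ l"
    by simp
qed

text \<open>The column of \<open>e\<close> has just two nonzero entries, -1 at the tail and 1 at the
  head. A loop would break this: \<open>incidence_matrix\<close> tests the tail first and would
  leave a lone -1.\<close>

lemma (in loopfree_digraph) sum_incidence_matrix:
  fixes w :: "'a \<Rightarrow> 'c::real_vector"
  assumes "finite (verts G)" "e \<in> arcs G"
  shows "(\<Sum>v\<in>verts G. incidence_matrix G v e *\<^sub>R w v) = w (head G e) - w (tail G e)"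
proof -
  have "(\<Sum>v\<in>verts G. incidence_matrix G v e *\<^sub>R w v)
      = (\<Sum>v\<in>verts G. (if v = head G e then w v else 0) - (if v = tail G e then w v else 0))"
    using no_loops[OF assms(2)] by (intro sum.cong) (auto simp: incidence_matrix_def)
  then show ?thesis
    using assms by (simp add: sum_subtractf)
qed

lemma (in wf_digraph) connected_imp_constant:
  assumes "Digraph_Component.connected G"
    and "\<And>e. e \<in> arcs G \<Longrightarrow> w (head G e) = w (tail G e)"
    and "u \<in> verts G" "v \<in> verts G"
  shows "w u = w v"
proof -
  have "(u, v) \<in> rtrancl_on (verts G) (parcs (mk_symmetric G))"
    using assms(1,3,4) by (auto simp: connected_def strongly_connected_def reachable_def)
  then show ?thesis
  proof (induction rule: rtrancl_on_induct)
    case base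
    show ?case ..
  next
    case (step x y)
    \<comment> \<open>Connectedness is reachability in the symmetric closure, so a step may traverse
      an arc of \<open>G\<close> in either direction; the equality of \<open>w\<close> at its ends
      serves both.\<close>
    then have "w x = w y"
      using assms(2) by (auto simp: parcs_mk_symmetric)
    with step show ?case by simp
  qed
qed

lemma network_equilibrium_consensus:
  fixes y :: "nat \<Rightarrow> real^'n::finite"
  assumes "loopfree_digraph G" "verts G = {1..N}" "arcs G = {1..K}"
    "Digraph_Component.connected G"
    and "\<forall>k\<in>{1..K}. integral_action (Phi k)"
    and eq: "network_equilibrium N K (incidence_matrix G) m chi psi Phi sgm x u y z zeta d"
    and "i \<in> {1..N}" "j \<in> {1..N}"
  shows "y i = y j"
proof -
  interpret loopfree_digraph G by fact
  have "y (head G k) = y (tail G k)" if "k \<in> arcs G" for k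
  proof -
    have k: "k \<in> {1..K}"
      using that assms(3) by simp
    have "zeta k = 0"
      using eq assms(5) k
      unfolding network_equilibrium_def controller_equilibrium_def integral_action_def by blast
    moreover have "zeta k = (\<Sum>v\<in>verts G. incidence_matrix G v k *\<^sub>R y v)"
      using eq k unfolding network_equilibrium_def assms(2)
      by (intro col_eq_kron_transpose_mat_vec[of _ _ "{1..K}"]) auto
    ultimately show ?thesis
      using sum_incidence_matrix[of k y] that assms(2) by simp
  qed
  then show ?thesis
    using connected_imp_constant[of y i j] assms(2,4,7,8) by simp
qed

lemma network_equilibrium_sum_inputs:
  fixes u :: "nat \<Rightarrow> real^'n::finite"
  assumes "loopfree_digraph G" "verts G = {1..N}" "arcs G = {1..K}"
    and eq: "network_equilibrium N K (incidence_matrix G) m chi psi Phi sgm x u y z zeta d"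
  shows "(\<Sum>i\<in>{1..N}. u i) = 0"
proof -
  interpret loopfree_digraph G by fact
  have "u i = (\<Sum>k\<in>arcs G. - incidence_matrix G i k *\<^sub>R d k)" if "i \<in> verts G" for i
    using eq that unfolding network_equilibrium_def assms(2,3)
    by (intro col_eq_kron_uminus_mat_vec[of _ _ "{1..N}"]) auto
  then have "(\<Sum>i\<in>verts G. u i)
      = (\<Sum>i\<in>verts G. \<Sum>k\<in>arcs G. - incidence_matrix G i k *\<^sub>R d k)"
    by (rule sum.cong[OF refl])
  also have "\<dots> = - (\<Sum>k\<in>arcs G. \<Sum>i\<in>verts G. incidence_matrix G i k *\<^sub>R d k)"
    by (subst sum.swap) (simp add: sum_negf)
  \<comment> \<open>For each arc the weight \<open>d k\<close> is the same at all vertices, so the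
    difference between head and tail is 0.\<close>
  also have "\<dots> = 0"
    using sum_incidence_matrix[of _ "\<lambda>_. d _"] assms(2) by simp
  finally show ?thesis
    using assms(2) by simp
qed

section \<open>Sufficiency of the KKT conditions\<close>

text \<open>Lagrangian sufficiency with constraints distributed over the agents: each has its own
  multipliers, and stationarity is required only of the sum of the gradients
  \<open>u i\<close>.\<close>

lemma kkt_point_is_minimizer:
  fixes f :: "nat \<Rightarrow> real^'n::finite \<Rightarrow> real"
  assumes fin: "\<And>i. i \<in> {1..N} \<Longrightarrow> finite (Cin i) \<and> finite (Ceq i)"
    and g: "\<And>i l. i \<in> {1..N} \<Longrightarrow> l \<in> Cin i \<Longrightarrow> convex_on UNIV (g i l)"
    and h: "\<And>i j y. i \<in> {1..N} \<Longrightarrow> j \<in> Ceq i \<Longrightarrow> h i j y = a i j \<bullet> y + c i j"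
    and f: "strictly_convex_on UNIV (\<lambda>y. \<Sum>i\<in>{1..N}. f i y)"
    and grad: "\<And>i. i \<in> {1..N} \<Longrightarrow>
      GDERIV (\<lambda>v. lagrangian (Cin i) (Ceq i) (f i) (g i) (h i) v (lam i) (mu i)) y0 :> u i"
    and "(\<Sum>i\<in>{1..N}. u i) = 0"
    and feas: "feasible N Cin Ceq g h y0"
    and lam: "\<And>i l. i \<in> {1..N} \<Longrightarrow> l \<in> Cin i \<Longrightarrow> lam i l \<ge> 0"
    and slack: "\<And>i l. i \<in> {1..N} \<Longrightarrow> l \<in> Cin i \<Longrightarrow> lam i l * g i l y0 = 0"
    and min: "is_arg_min (\<lambda>y. \<Sum>i\<in>{1..N}. f i y) (feasible N Cin Ceq g h) ystar"
  shows "y0 = ystar"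
proof (rule ccontr)
  assume neq: "y0 \<noteq> ystar"
  let ?F = "\<lambda>v. \<Sum>i\<in>{1..N}. f i v"
  let ?P = "\<lambda>v. \<Sum>i\<in>{1..N}. (\<Sum>l\<in>Cin i. lam i l * g i l v) + (\<Sum>j\<in>Ceq i. mu i j * h i j v)"
  have "convex_on UNIV (\<lambda>v. mu i j * h i j v)" if "i \<in> {1..N}" "j \<in> Ceq i" for i j
    using convex_on_affine[of "mu i j" "a i j" "c i j"] h[OF that] by simp
  then have P: "convex_on UNIV ?P"
    using fin g lam
    by (intro convex_on_sum_functions convex_on_add) (auto intro: convex_on_cmul)
  have L: "(\<Sum>i\<in>{1..N}. lagrangian (Cin i) (Ceq i) (f i) (g i) (h i) v (lam i) (mu i))
      = ?F v + ?P v" for v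
    by (simp add: lagrangian_def sum.distrib add.assoc)
  have "GDERIV (\<lambda>v. ?F v + ?P v) y0 :> 0"
    \<comment> \<open>After \<open>OF\<close>, the agent index in \<open>grad\<close> is a function
      of the summation index; \<open>\<lambda>i. i\<close> makes the two coincide.\<close>
    using GDERIV_sum[OF grad, of "{1..N}" "\<lambda>i. i"] assms(6) by (simp only: L)
  then have "?F y0 + ?P y0 < ?F ystar + ?P ystar"
    using strictly_convex_critical_point_is_strict_minimum[OF strictly_convex_on_add_convex[OF f P]]
      neq by blast
  moreover have "?P y0 = 0"
  proof (rule sum.neutral, rule ballI)
    fix i assume i: "i \<in> {1..N}"
    have "(\<Sum>l\<in>Cin i. lam i l * g i l y0) = 0"
      by (rule sum.neutral) (use slack[OF i] in blast)
    moreover have "(\<Sum>j\<in>Ceq i. mu i j * h i j y0) = 0"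
      using feas i by (intro sum.neutral ballI) (simp add: feasible_def)
    ultimately show "(\<Sum>l\<in>Cin i. lam i l * g i l y0) + (\<Sum>j\<in>Ceq i. mu i j * h i j y0) = 0"
      by simp
  qed
  \<comment> \<open>Feasibility of \<open>ystar\<close> kills the equality terms and, as
    \<open>lam\<close> is nonnegative, makes each inequality term nonpositive.\<close>
  moreover have "?P ystar \<le> 0"
  proof (rule sum_nonpos)
    fix i assume i: "i \<in> {1..N}"
    have star: "feasible N Cin Ceq g h ystar"
      using min by (simp add: is_arg_min_def)
    have "(\<Sum>j\<in>Ceq i. mu i j * h i j ystar) = 0"
      using star i by (intro sum.neutral ballI) (simp add: feasible_def)
    moreover have "(\<Sum>l\<in>Cin i. lam i l * g i l ystar) \<le> 0"
      using star i lam by (intro sum_nonpos mult_nonneg_nonpos) (auto simp: feasible_def)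
    ultimately show "(\<Sum>l\<in>Cin i. lam i l * g i l ystar) + (\<Sum>j\<in>Ceq i. mu i j * h i j ystar) \<le> 0"
      by simp
  qed
  ultimately have "?F y0 < ?F ystar" by linarith
  then show False
    using min feas unfolding is_arg_min_def by blast
qed

theorem theorem12:
  fixes N K :: nat
    and G :: "(nat, nat) pre_digraph"
    and Cin :: "nat \<Rightarrow> 'l set" and Ceq :: "nat \<Rightarrow> 'j set"
    and f :: "nat \<Rightarrow> real^'n::finite \<Rightarrow> real"
    and g :: "nat \<Rightarrow> 'l \<Rightarrow> real^'n \<Rightarrow> real"
    and h :: "nat \<Rightarrow> 'j \<Rightarrow> real^'n \<Rightarrow> real"
    and a :: "nat \<Rightarrow> 'j \<Rightarrow> real^'n" and c :: "nat \<Rightarrow> 'j \<Rightarrow> real"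
    and ystar :: "real^'n"
    and m :: "nat \<Rightarrow> nat"
    and chi :: "nat \<Rightarrow> (nat \<Rightarrow> real) \<Rightarrow> real^'n \<Rightarrow> nat \<Rightarrow> real"
    and psi :: "nat \<Rightarrow> (nat \<Rightarrow> real) \<Rightarrow> real^'n \<Rightarrow> real^'n"
    and Phi :: "nat \<Rightarrow> real^'n \<Rightarrow> real^'n \<Rightarrow> real^'n"
    and sgm :: "nat \<Rightarrow> real^'n \<Rightarrow> real^'n"
  assumes graph: "loopfree_digraph G" "verts G = {1..N}" "arcs G = {1..K}"
      "Digraph_Component.connected G"
    and finite_constraints: "\<forall>i\<in>{1..N}. finite (Cin i) \<and> finite (Ceq i)"
    and differentiable_f: "\<forall>i\<in>{1..N}. \<forall>y. f i differentiable (at y)"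
    and differentiable_g: "\<forall>i\<in>{1..N}. \<forall>l\<in>Cin i. \<forall>y. g i l differentiable (at y)"
    and differentiable_h: "\<forall>i\<in>{1..N}. \<forall>j\<in>Ceq i. \<forall>y. h i j differentiable (at y)"
    and convex_g: "\<forall>i\<in>{1..N}. \<forall>l\<in>Cin i. convex_on UNIV (g i l)"
    and affine_h: "\<forall>i\<in>{1..N}. \<forall>j\<in>Ceq i. \<forall>y. h i j y = a i j \<bullet> y + c i j"
    and strictly_convex: "strictly_convex_on UNIV (\<lambda>y. \<Sum>i\<in>{1..N}. f i y)"
    and slater: "slater N Cin Ceq g h"
    and minimizer: "is_arg_min (\<lambda>y. \<Sum>i\<in>{1..N}. f i y) (feasible N Cin Ceq g h) ystar"
    and agents: "\<forall>i\<in>{1..N}. \<forall>x u y. agent_equilibrium (m i) (chi i) (psi i) x u y \<longrightarrow>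
      (\<exists>lam mu.
         GDERIV (\<lambda>v. lagrangian (Cin i) (Ceq i) (f i) (g i) (h i) v lam mu) y :> u \<and>
         (\<forall>l\<in>Cin i. g i l y \<le> 0) \<and> (\<forall>j\<in>Ceq i. h i j y = 0) \<and>
         (\<forall>l\<in>Cin i. lam l \<ge> 0) \<and> (\<forall>l\<in>Cin i. lam l * g i l y = 0))"
    and controllers: "\<forall>k\<in>{1..K}. integral_action (Phi k)"
  shows "\<forall>x u y z zeta d.
    network_equilibrium N K (incidence_matrix G) m chi psi Phi sgm x u y z zeta d \<longrightarrow>
    (col {1..N} y, col {1..K} d) \<in> equilibrium_manifold N K ystar"
proof (intro allI impI)
  fix x u y z zeta d
  assume eq: "network_equilibrium N K (incidence_matrix G) m chi psi Phi sgm x u y z zeta d"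
  have agent: "\<exists>lam mu.
      GDERIV (\<lambda>v. lagrangian (Cin i) (Ceq i) (f i) (g i) (h i) v lam mu) (y i) :> u i \<and>
      (\<forall>l\<in>Cin i. g i l (y i) \<le> 0) \<and> (\<forall>j\<in>Ceq i. h i j (y i) = 0) \<and>
      (\<forall>l\<in>Cin i. lam l \<ge> 0) \<and> (\<forall>l\<in>Cin i. lam l * g i l (y i) = 0)" if "i \<in> {1..N}" for i
    using eq agents that unfolding network_equilibrium_def by blast
  then obtain lam mu where kkt: "\<And>i. i \<in> {1..N} \<Longrightarrow>
      GDERIV (\<lambda>v. lagrangian (Cin i) (Ceq i) (f i) (g i) (h i) v (lam i) (mu i)) (y i) :> u i \<and>
      (\<forall>l\<in>Cin i. g i l (y i) \<le> 0) \<and> (\<forall>j\<in>Ceq i. h i j (y i) = 0) \<and>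
      (\<forall>l\<in>Cin i. lam i l \<ge> 0) \<and> (\<forall>l\<in>Cin i. lam i l * g i l (y i) = 0)"
    by metis
  have "y i0 = ystar" if i0: "i0 \<in> {1..N}" for i0
  proof -
    \<comment> \<open>Agent \<open>i0\<close> serves as reference: consensus moves the conditions of
      every agent to the common point \<open>y i0\<close>.\<close>
    have same: "y i = y i0" if "i \<in> {1..N}" for i
      using network_equilibrium_consensus[OF graph controllers eq that i0] .
    show ?thesis
    proof (rule kkt_point_is_minimizer[OF _ _ _ strictly_convex _ _ _ _ _ minimizer])
      show "GDERIV (\<lambda>v. lagrangian (Cin i) (Ceq i) (f i) (g i) (h i) v (lam i) (mu i)) (y i0) :> u i"
        if "i \<in> {1..N}" for i
        using kkt[OF that] same[OF that] by simp
      show "(\<Sum>i\<in>{1..N}. u i) = 0"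
        using network_equilibrium_sum_inputs[OF graph(1-3) eq] .
      show "feasible N Cin Ceq g h (y i0)"
        using kkt same by (simp add: feasible_def)
      show "lam i l * g i l (y i0) = 0" if "i \<in> {1..N}" "l \<in> Cin i" for i l
        using kkt[OF that(1)] same[OF that(1)] that(2) by simp
    qed (use finite_constraints convex_g affine_h kkt in auto)
  qed
  \<comment> \<open>The manifold leaves the values of \<open>d\<close> free, so for that component
    only extensionality is to be checked.\<close>
  then show "(col {1..N} y, col {1..K} d) \<in> equilibrium_manifold N K ystar"
    by (auto simp: equilibrium_manifold_def stacked_def col_def kron_vec_def stack_index_def
        intro!: restrict_ext)
qed

end
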